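(* $(I_2(\mathbb{R}),D_{M_2})$ is a complete metric space.
   Context: A Type-2 interval is given by four real numbers $\underline{a}_L\le\overline{a}_L\le\underline{a}_U\le\overline{a}_U$ and is written $A=[(\underline{a}_L,\overline{a}_L),(\underline{a}_U,\overline{a}_U)]$; it represents the intervals $[a_L,a_U]$ with $a_L\in[\underline{a}_L,\overline{a}_L]$ and $a_U\in[\underline{a}_U,\overline{a}_U]$. $I_2(\mathbb{R})$ denotes the set of all Type-2 intervals. Two Type-2 intervals are equal if and only if their four corresponding entries are equal. The extended Moore distance between $X=[(\underline{x}_L,\overline{x}_L),(\underline{x}_U,\overline{x}_U)]$ and $Y=[(\underline{y}_L,\overline{y}_L),(\underline{y}_U,\overline{y}_U)]$ is $$D_{M_2}(X,Y)=\max\{|\underline{x}_L-\underline{y}_L|,\ |\overline{x}_L-\overline{y}_L|,\ |\underline{x}_U-\underline{y}_U|,\ |\overline{x}_U-\overline{y}_U|\}.$$ *)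

theory Defs
  imports "HOL-Analysis.Abstract_Metric_Spaces"
begin

text \<open>
  The interval \<open>[(l\<^sub>1, l\<^sub>2), (u\<^sub>1, u\<^sub>2)]\<close> is encoded as \<open>T2 l\<^sub>1 l\<^sub>2 u\<^sub>1 u\<^sub>2\<close>. The datatype itself
  contains arbitrary quadruples; the ordering constraint is imposed by the carrier \<open>I2\<close>.
\<close>

datatype quad = T2 (lower_L: real) (upper_L: real) (lower_U: real) (upper_U: real)

definition I2 :: "quad set" where
  "I2 = {A. lower_L A \<le> upper_L A \<and> upper_L A \<le> lower_U A \<and> lower_U A \<le> upper_U A}"

definition D_M2 :: "quad \<Rightarrow> quad \<Rightarrow> real" where
  "D_M2 X Y = Max {\<bar>lower_L X - lower_L Y\<bar>, \<bar>upper_L X - upper_L Y\<bar>,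
                   \<bar>lower_U X - lower_U Y\<bar>, \<bar>upper_U X - upper_U Y\<bar>}"

end

theory Submission imports Defs begin

text \<open>Reading an interval as its four endpoints, \<open>D_M2\<close> is the maximum metric on
  \<real>^4 and \<open>I2\<close> is a subset cut out by weak inequalities, hence closed; a closed
  subset of a complete space is complete. The argument works coordinatewise:
  \<open>D_M2_le_iff\<close> reduces the metric axioms to those of the real line, and
  \<open>D_M2_less_iff\<close> does the same for Cauchy sequences and limits.\<close>

lemma D_M2_less_iff:
  "D_M2 X Y < e \<longleftrightarrow>
    dist (lower_L X) (lower_L Y) < e \<and> dist (upper_L X) (upper_L Y) < e \<and>
    dist (lower_U X) (lower_U Y) < e \<and> dist (upper_U X) (upper_U Y) < e"
  by (simp add: D_M2_def dist_real_def)

lemma D_M2_le_iff: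
  "D_M2 X Y \<le> e \<longleftrightarrow>
    dist (lower_L X) (lower_L Y) \<le> e \<and> dist (upper_L X) (upper_L Y) \<le> e \<and>
    dist (lower_U X) (lower_U Y) \<le> e \<and> dist (upper_U X) (upper_U Y) \<le> e"
  by (simp add: D_M2_def dist_real_def)

lemma Metric_space_I2: "Metric_space I2 D_M2"
proof
  fix X Y Z
  show "D_M2 X Y = D_M2 Y X"
    by (simp add: D_M2_def abs_minus_commute)
  have nonneg: "0 \<le> D_M2 X Y"
    by (simp add: D_M2_def le_max_iff_disj)
  then show "0 \<le> D_M2 X Y" .
  \<comment> \<open>Given nonnegativity, distance 0 means distance at most 0, which forces all four
    coordinate distances to vanish.\<close>
  show "D_M2 X Y = 0 \<longleftrightarrow> X = Y"
    using nonneg D_M2_le_iff[of X Y 0] by (cases X; cases Y) auto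
  show "D_M2 X Z \<le> D_M2 X Y + D_M2 Y Z"
  proof -
    \<comment> \<open>Here \<open>f\<close> stands for any of the four endpoint selectors; its two
      premises come from \<open>D_M2_le_iff\<close> with the distance itself as the bound.\<close>
    have triangle: "dist (f X) (f Z) \<le> D_M2 X Y + D_M2 Y Z"
      if "dist (f X) (f Y) \<le> D_M2 X Y" "dist (f Y) (f Z) \<le> D_M2 Y Z" for f :: "quad \<Rightarrow> real"
      using dist_triangle[of "f X" "f Z" "f Y"] that by linarith
    show ?thesis
      using D_M2_le_iff[of X Y "D_M2 X Y"] D_M2_le_iff[of Y Z "D_M2 Y Z"]
      by (simp add: D_M2_le_iff[of X Z] triangle)
  qed
qed

text \<open>Only four coordinates are involved, so their four "eventually closer than e" conditions
  combine into a single one, which is closeness in \<open>D_M2\<close>.\<close>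

lemma limitin_I2:
  assumes "L \<in> I2" and "\<And>n. \<sigma> n \<in> I2"
    and "(\<lambda>n. lower_L (\<sigma> n)) \<longlonglongrightarrow> lower_L L" and "(\<lambda>n. upper_L (\<sigma> n)) \<longlonglongrightarrow> upper_L L"
    and "(\<lambda>n. lower_U (\<sigma> n)) \<longlonglongrightarrow> lower_U L" and "(\<lambda>n. upper_U (\<sigma> n)) \<longlonglongrightarrow> upper_U L"
  shows "limitin (Metric_space.mtopology I2 D_M2) \<sigma> L sequentially"
  using assms
  by (simp add: Metric_space.limitin_metric[OF Metric_space_I2] D_M2_less_iff tendsto_iff
      eventually_conj_iff)

lemma mcomplete_I2: "Metric_space.mcomplete I2 D_M2"
proof -
  interpret Metric_space I2 D_M2
    by (rule Metric_space_I2)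
  show ?thesis
    unfolding mcomplete_def
  proof (intro allI impI)
    fix \<sigma> assume "MCauchy \<sigma>"
    then have in_I2: "\<sigma> n \<in> I2" for n
      unfolding MCauchy_def by blast
    have Cauchy: "\<exists>N. \<forall>m\<ge>N. \<forall>n\<ge>N. D_M2 (\<sigma> m) (\<sigma> n) < e" if "e > 0" for e
      using \<open>MCauchy \<sigma>\<close> that by (simp add: MCauchy_def)
    \<comment> \<open>The premise says that \<open>f\<close> is 1-Lipschitz, so it maps
      \<open>\<sigma>\<close> to a Cauchy sequence of reals, which converges.\<close>
    have conv: "convergent (\<lambda>n. f (\<sigma> n))"
      if "\<And>X Y e. D_M2 X Y < e \<Longrightarrow> dist (f X) (f Y) < e" for f :: "quad \<Rightarrow> real"
      unfolding Cauchy_convergent_iff[symmetric] Cauchy_def by (meson Cauchy that)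
    have "convergent (\<lambda>n. lower_L (\<sigma> n))" "convergent (\<lambda>n. upper_L (\<sigma> n))"
      "convergent (\<lambda>n. lower_U (\<sigma> n))" "convergent (\<lambda>n. upper_U (\<sigma> n))"
      by (rule conv, simp add: D_M2_less_iff)+
    then obtain a b c d where
      lims: "(\<lambda>n. lower_L (\<sigma> n)) \<longlonglongrightarrow> a" "(\<lambda>n. upper_L (\<sigma> n)) \<longlonglongrightarrow> b"
        "(\<lambda>n. lower_U (\<sigma> n)) \<longlonglongrightarrow> c" "(\<lambda>n. upper_U (\<sigma> n)) \<longlonglongrightarrow> d"
      unfolding convergent_def by blast
    \<comment> \<open>This is where closedness of \<open>I2\<close> enters: weak inequalities
      between sequences survive in the limit, so the limit is again a Type-2 interval.\<close>
    have "a \<le> b" "b \<le> c" "c \<le> d"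
      using lims in_I2 unfolding I2_def mem_Collect_eq by (blast intro: LIMSEQ_le)+
    then have "T2 a b c d \<in> I2"
      by (simp add: I2_def)
    then show "\<exists>L. limitin mtopology \<sigma> L sequentially"
      using limitin_I2[of "T2 a b c d" \<sigma>] in_I2 lims by auto
  qed
qed

theorem theorem5p6:
  "Metric_space I2 D_M2 \<and> Metric_space.mcomplete I2 D_M2"
  using Metric_space_I2 mcomplete_I2 ..

end
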